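(* Let $R$ be a minimal rotational surface in $\mathbb{E}^3$ and let $\alpha$ be a loxodrome on $R$ that intersects the meridian curves of $R$ at the angle $\psi=\frac{\pi}{4}$ at every point. Then $\alpha$ is an asymptotic curve of $R$.
   Context: A rotational surface $R$ is given by an immersion $\Phi(s,\theta)=(f(s)\cos\theta,f(s)\sin\theta,g(s))$ with $f,g$ smooth on an open interval and $f'^2+g'^2=1$. $R$ is minimal if its mean curvature vanishes identically. Meridians are the curves $s\mapsto\Phi(s,\theta)$ with $\theta$ fixed. A loxodrome on $R$ is a regular curve $\alpha(t)=\Phi(s(t),\theta(t))$ such that the angle between $\dot\alpha(t)$ and $\Phi_s(s(t),\theta(t))$ is a constant $\psi\in[0,\pi]$. With $II$ the second fundamental form of $R$, a regular curve $\alpha$ on $R$ is an asymptotic curve if $II(\dot\alpha,\dot\alpha)=0$ along it. *)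

theory Defs
  imports "HOL-Analysis.Analysis"
begin

text \<open>Only used with an open set \<open>S\<close>, where the iterated derivatives at points of \<open>S\<close>
  depend only on the values of the function on \<open>S\<close>.\<close>

definition smooth_on :: "real set \<Rightarrow> (real \<Rightarrow> real) \<Rightarrow> bool" where
  "smooth_on S h \<longleftrightarrow> (\<forall>k. (deriv ^^ k) h differentiable_on S)"

definition angle :: "'a::real_inner \<Rightarrow> 'a \<Rightarrow> real" where
  "angle x y = arccos (x \<bullet> y / (norm x * norm y))"

section \<open>Parametrized surfaces in Euclidean 3-space\<close>

definition partial_u :: "(real \<times> real \<Rightarrow> real^3) \<Rightarrow> real \<times> real \<Rightarrow> real^3" where
  "partial_u X p = vector_derivative (\<lambda>u. X (u, snd p)) (at (fst p))"

definition partial_v :: "(real \<times> real \<Rightarrow> real^3) \<Rightarrow> real \<times> real \<Rightarrow> real^3" where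
  "partial_v X p = vector_derivative (\<lambda>v. X (fst p, v)) (at (snd p))"

definition immersion_on :: "(real \<times> real) set \<Rightarrow> (real \<times> real \<Rightarrow> real^3) \<Rightarrow> bool" where
  "immersion_on D X \<longleftrightarrow>
     (\<forall>p\<in>D. X differentiable (at p) \<and> inj (frechet_derivative X (at p)))"

definition unit_normal :: "(real \<times> real \<Rightarrow> real^3) \<Rightarrow> real \<times> real \<Rightarrow> real^3" where
  "unit_normal X p = sgn (cross3 (partial_u X p) (partial_v X p))"

definition first_E :: "(real \<times> real \<Rightarrow> real^3) \<Rightarrow> real \<times> real \<Rightarrow> real" where
  "first_E X p = partial_u X p \<bullet> partial_u X p"

definition first_F :: "(real \<times> real \<Rightarrow> real^3) \<Rightarrow> real \<times> real \<Rightarrow> real" where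
  "first_F X p = partial_u X p \<bullet> partial_v X p"

definition first_G :: "(real \<times> real \<Rightarrow> real^3) \<Rightarrow> real \<times> real \<Rightarrow> real" where
  "first_G X p = partial_v X p \<bullet> partial_v X p"

definition second_L :: "(real \<times> real \<Rightarrow> real^3) \<Rightarrow> real \<times> real \<Rightarrow> real" where
  "second_L X p = partial_u (partial_u X) p \<bullet> unit_normal X p"

definition second_M :: "(real \<times> real \<Rightarrow> real^3) \<Rightarrow> real \<times> real \<Rightarrow> real" where
  "second_M X p = partial_v (partial_u X) p \<bullet> unit_normal X p"

definition second_N :: "(real \<times> real \<Rightarrow> real^3) \<Rightarrow> real \<times> real \<Rightarrow> real" where
  "second_N X p = partial_v (partial_v X) p \<bullet> unit_normal X p"

text \<open>The coordinates of a tangent vector in the basis of the two partial derivatives;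
  meaningful only if \<open>X\<close> is an immersion at \<open>p\<close> and \<open>w\<close> is tangent there.\<close>

definition tangent_coords ::
    "(real \<times> real \<Rightarrow> real^3) \<Rightarrow> real \<times> real \<Rightarrow> real^3 \<Rightarrow> real \<times> real" where
  "tangent_coords X p w =
     (THE c. w = fst c *\<^sub>R partial_u X p + snd c *\<^sub>R partial_v X p)"

definition second_fundamental_form ::
    "(real \<times> real \<Rightarrow> real^3) \<Rightarrow> real \<times> real \<Rightarrow> real^3 \<Rightarrow> real^3 \<Rightarrow> real" where
  "second_fundamental_form X p w z =
     (case (tangent_coords X p w, tangent_coords X p z) of
        ((a, b), (c, d)) \<Rightarrow>
          a * c * second_L X p + (a * d + b * c) * second_M X p + b * d * second_N X p)"

text \<open>Half the trace of the shape operator, written in the coefficients of the two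
  fundamental forms.\<close>

definition mean_curvature :: "(real \<times> real \<Rightarrow> real^3) \<Rightarrow> real \<times> real \<Rightarrow> real" where
  "mean_curvature X p =
     (second_L X p * first_G X p - 2 * second_M X p * first_F X p + second_N X p * first_E X p)
     / (2 * (first_E X p * first_G X p - (first_F X p)\<^sup>2))"

definition minimal_on :: "(real \<times> real) set \<Rightarrow> (real \<times> real \<Rightarrow> real^3) \<Rightarrow> bool" where
  "minimal_on D X \<longleftrightarrow> (\<forall>p\<in>D. mean_curvature X p = 0)"

section \<open>Curves on a parametrized surface\<close>

definition curve_on_surface ::
    "(real \<times> real \<Rightarrow> real^3) \<Rightarrow> (real \<Rightarrow> real) \<Rightarrow> (real \<Rightarrow> real) \<Rightarrow> real \<Rightarrow> real^3" where
  "curve_on_surface X u v t = X (u t, v t)"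

definition velocity :: "(real \<Rightarrow> real^3) \<Rightarrow> real \<Rightarrow> real^3" where
  "velocity \<alpha> t = vector_derivative \<alpha> (at t)"

definition regular_curve_on ::
    "(real \<times> real) set \<Rightarrow> (real \<times> real \<Rightarrow> real^3) \<Rightarrow> real set \<Rightarrow>
      (real \<Rightarrow> real) \<Rightarrow> (real \<Rightarrow> real) \<Rightarrow> bool" where
  "regular_curve_on D X J u v \<longleftrightarrow>
     open J \<and> is_interval J \<and> smooth_on J u \<and> smooth_on J v \<and>
     (\<forall>t\<in>J. (u t, v t) \<in> D \<and> velocity (curve_on_surface X u v) t \<noteq> 0)"

definition asymptotic_curve ::
    "(real \<times> real) set \<Rightarrow> (real \<times> real \<Rightarrow> real^3) \<Rightarrow> real set \<Rightarrow>
      (real \<Rightarrow> real) \<Rightarrow> (real \<Rightarrow> real) \<Rightarrow> bool" where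
  "asymptotic_curve D X J u v \<longleftrightarrow>
     regular_curve_on D X J u v \<and>
     (\<forall>t\<in>J. second_fundamental_form X (u t, v t)
        (velocity (curve_on_surface X u v) t) (velocity (curve_on_surface X u v) t) = 0)"

section \<open>Rotational surfaces\<close>

definition rot_param :: "(real \<Rightarrow> real) \<Rightarrow> (real \<Rightarrow> real) \<Rightarrow> real \<times> real \<Rightarrow> real^3" where
  "rot_param f g = (\<lambda>(s, \<theta>). vector [f s * cos \<theta>, f s * sin \<theta>, g s])"

definition rotational_surface ::
    "real set \<Rightarrow> (real \<Rightarrow> real) \<Rightarrow> (real \<Rightarrow> real) \<Rightarrow> bool" where
  "rotational_surface I f g \<longleftrightarrow>
     open I \<and> is_interval I \<and> smooth_on I f \<and> smooth_on I g \<and>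
     (\<forall>s\<in>I. (deriv f s)\<^sup>2 + (deriv g s)\<^sup>2 = 1) \<and>
     immersion_on (I \<times> UNIV) (rot_param f g)"

definition minimal_rotational_surface ::
    "real set \<Rightarrow> (real \<Rightarrow> real) \<Rightarrow> (real \<Rightarrow> real) \<Rightarrow> bool" where
  "minimal_rotational_surface I f g \<longleftrightarrow>
     rotational_surface I f g \<and> minimal_on (I \<times> UNIV) (rot_param f g)"

text \<open>The velocity of the meridian through \<open>(s, \<theta>)\<close> is \<^term>\<open>partial_u (rot_param f g) (s, \<theta>)\<close>.\<close>

definition loxodrome ::
    "real set \<Rightarrow> (real \<Rightarrow> real) \<Rightarrow> (real \<Rightarrow> real) \<Rightarrow> real set \<Rightarrow>
      (real \<Rightarrow> real) \<Rightarrow> (real \<Rightarrow> real) \<Rightarrow> real \<Rightarrow> bool" where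
  "loxodrome I f g J s \<theta> \<psi> \<longleftrightarrow>
     regular_curve_on (I \<times> UNIV) (rot_param f g) J s \<theta> \<and> \<psi> \<in> {0..pi} \<and>
     (\<forall>t\<in>J. angle (velocity (curve_on_surface (rot_param f g) s \<theta>) t)
               (partial_u (rot_param f g) (s t, \<theta> t)) = \<psi>)"

end

theory Submission
  imports Defs
begin

text \<open>The coordinates of a rotational surface satisfy \<open>F = M = 0\<close>, so minimality reads
  \<open>L G + N E = 0\<close>. A tangent vector \<open>a X\<^sub>u + b X\<^sub>v\<close> making the angle \<open>\<pi>/4\<close> with \<open>X\<^sub>u\<close>
  satisfies \<open>a\<^sup>2 E = b\<^sup>2 G\<close>, hence \<open>E (a\<^sup>2 L + b\<^sup>2 N) = b\<^sup>2 (L G + N E) = 0\<close>.\<close>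

lemma smooth_on_imp_has_real_derivative:
  assumes "smooth_on S h" "open S" "x \<in> S"
  shows "(h has_real_derivative deriv h x) (at x)"
proof -
  have "(deriv ^^ 0) h differentiable_on S"
    using assms(1) unfolding smooth_on_def by blast
  then have "h differentiable (at x)"
    using assms(2,3) differentiable_on_eq_differentiable_at by fastforce
  then show ?thesis
    by (simp add: DERIV_deriv_iff_real_differentiable)
qed

lemma has_vector_derivative_vector_3:
  assumes "(a has_real_derivative a') (at x)"
    and "(b has_real_derivative b') (at x)"
    and "(c has_real_derivative c') (at x)"
  shows "((\<lambda>t. vector [a t, b t, c t] :: real^3) has_vector_derivative vector [a', b', c']) (at x)"
proof -
  \<comment> \<open>In the standard basis the triple is a sum of scalar functions times constant
    vectors, a form that \<open>derivative_eq_intros\<close> can handle.\<close>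
  have *: "(vector [p, q, r] :: real^3) = p *\<^sub>R axis 1 1 + q *\<^sub>R axis 2 1 + r *\<^sub>R axis 3 1"
    for p q r :: real
    by (simp add: vec_eq_iff forall_3 axis_def)
  show ?thesis
    unfolding * using assms
    by (auto intro!: derivative_eq_intros)
qed

text \<open>By the chain rule along the two coordinate lines, the partials are the values of the
  differential at \<open>(1, 0)\<close> and \<open>(0, 1)\<close>; linearity does the rest. This
  turns injectivity of the differential into linear independence of the partials.\<close>

lemma frechet_derivative_eq_partials:
  assumes "X differentiable (at p)"
  shows "frechet_derivative X (at p) (a, b) = a *\<^sub>R partial_u X p + b *\<^sub>R partial_v X p"
proof -
  let ?D = "frechet_derivative X (at p)"
  obtain u v where p: "p = (u, v)" by fastforce
  have D: "(X has_derivative ?D) (at (u, v))"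
    using assms frechet_derivative_works p by blast
  interpret linear ?D
    using D p by (auto intro: has_derivative_linear)
  have "((\<lambda>x. X (x, v)) has_vector_derivative ?D (1, 0)) (at u)"
  proof -
    have "((\<lambda>x. (x, v)) has_vector_derivative (1, 0)) (at u)"
      by (auto intro!: derivative_eq_intros)
    then show ?thesis
      using vector_derivative_diff_chain_within[of "\<lambda>x. (x, v)" "(1, 0)" u UNIV X ?D]
        has_derivative_at_withinI[OF D] by (simp add: o_def)
  qed
  then have u: "partial_u X p = ?D (1, 0)"
    unfolding partial_u_def p by (simp add: vector_derivative_at)
  have "((\<lambda>y. X (u, y)) has_vector_derivative ?D (0, 1)) (at v)"
  proof -
    have "((\<lambda>y. (u, y)) has_vector_derivative (0, 1)) (at v)"
      by (auto intro!: derivative_eq_intros)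
    then show ?thesis
      using vector_derivative_diff_chain_within[of "\<lambda>y. (u, y)" "(0, 1)" v UNIV X ?D]
        has_derivative_at_withinI[OF D] by (simp add: o_def)
  qed
  then have v: "partial_v X p = ?D (0, 1)"
    unfolding partial_v_def p by (simp add: vector_derivative_at)
  have "?D (a, b) = ?D (a *\<^sub>R (1, 0) + b *\<^sub>R (0, 1))" by simp
  also have "\<dots> = a *\<^sub>R partial_u X p + b *\<^sub>R partial_v X p"
    unfolding u v by (simp only: add scale)
  finally show ?thesis .
qed

lemma velocity_curve_on_surface:
  assumes "X differentiable (at (u t, v t))"
    and u: "(u has_real_derivative u') (at t)" and v: "(v has_real_derivative v') (at t)"
  shows "velocity (curve_on_surface X u v) t
    = u' *\<^sub>R partial_u X (u t, v t) + v' *\<^sub>R partial_v X (u t, v t)"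
proof -
  let ?D = "frechet_derivative X (at (u t, v t))"
  have "(X has_derivative ?D) (at (u t, v t))"
    using assms(1) frechet_derivative_works by blast
  moreover have "((\<lambda>t. (u t, v t)) has_vector_derivative (u', v')) (at t)"
    using u v by (auto intro!: derivative_eq_intros
        simp: has_real_derivative_iff_has_vector_derivative)
  ultimately have "((\<lambda>t. X (u t, v t)) has_vector_derivative ?D (u', v')) (at t)"
    using vector_derivative_diff_chain_within[of "\<lambda>t. (u t, v t)" "(u', v')" t UNIV X ?D]
      has_derivative_at_withinI by (fastforce simp: o_def)
  then show ?thesis
    unfolding velocity_def curve_on_surface_def frechet_derivative_eq_partials[OF assms(1)]
    by (rule vector_derivative_at)
qed

text \<open>Injectivity of the differential makes the coordinates of \<open>w\<close> unique, so the
  description in \<open>tangent_coords\<close> selects \<open>(a, b)\<close>.\<close>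

lemma second_fundamental_form_partials:
  assumes X: "X differentiable (at p)" and inj: "inj (frechet_derivative X (at p))"
    and w: "w = a *\<^sub>R partial_u X p + b *\<^sub>R partial_v X p"
  shows "second_fundamental_form X p w w
    = a\<^sup>2 * second_L X p + 2 * a * b * second_M X p + b\<^sup>2 * second_N X p"
proof -
  note D = frechet_derivative_eq_partials[OF X, symmetric]
  have "tangent_coords X p w = (a, b)"
    unfolding tangent_coords_def w D using injD[OF inj] by (intro the_equality) auto
  then show ?thesis
    by (simp add: second_fundamental_form_def power2_eq_square algebra_simps)
qed

text \<open>Since cos(pi/4) squared is 1/2, the part of \<open>w\<close> along \<open>x\<close>
  carries half of the squared length of \<open>w\<close>. By Pythagoras the part along
  \<open>y\<close> carries the other half.\<close>

lemma angle_quarter_orthogonal: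
  fixes x y :: "'a::real_inner"
  assumes orth: "x \<bullet> y = 0" and x: "x \<noteq> 0" and w: "w = a *\<^sub>R x + b *\<^sub>R y" "w \<noteq> 0"
    and ang: "angle w x = pi / 4"
  shows "a\<^sup>2 * (x \<bullet> x) = b\<^sup>2 * (y \<bullet> y)"
proof -
  let ?q = "w \<bullet> x / (norm w * norm x)"
  \<comment> \<open>Cauchy-Schwarz puts the quotient in the range where \<open>cos\<close> undoes
    \<open>arccos\<close>.\<close>
  have "\<bar>?q\<bar> \<le> 1"
    using Cauchy_Schwarz_ineq2[of w x] x w(2) by (simp add: abs_mult)
  then have "?q = cos (pi / 4)"
    using ang unfolding angle_def by (metis cos_arccos_abs)
  then have "?q\<^sup>2 = 1 / 2"
    by (simp only: cos_45) (simp add: power_divide)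
  then have "(w \<bullet> x)\<^sup>2 / ((w \<bullet> w) * (x \<bullet> x)) = 1 / 2"
    by (simp only: power_divide power_mult_distrib power2_norm_eq_inner)
  then have "2 * (w \<bullet> x)\<^sup>2 = (w \<bullet> w) * (x \<bullet> x)"
    using x w(2) by (simp add: field_simps)
  moreover have "w \<bullet> x = a * (x \<bullet> x)"
    using orth by (simp add: w(1) inner_simps inner_commute)
  moreover have "w \<bullet> w = a\<^sup>2 * (x \<bullet> x) + b\<^sup>2 * (y \<bullet> y)"
    using orth by (simp add: w(1) inner_simps inner_commute power2_eq_square)
  ultimately have "(x \<bullet> x) * (a\<^sup>2 * (x \<bullet> x) - b\<^sup>2 * (y \<bullet> y)) = 0"
    by (simp add: algebra_simps power2_eq_square)
  then show ?thesis using x by simp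
qed

text \<open>With F = M = 0 the coordinate directions are principal, and H = 0 makes the principal
  curvatures opposite. Euler's formula k cos^2 - k sin^2 then vanishes at pi/4. Nothing here refers
  to rotation.\<close>

lemma asymptotic_direction_of_angle_quarter:
  assumes X: "X differentiable (at p)" and inj: "inj (frechet_derivative X (at p))"
    and F: "first_F X p = 0" and M: "second_M X p = 0" and H: "mean_curvature X p = 0"
    and w: "w = a *\<^sub>R partial_u X p + b *\<^sub>R partial_v X p" "w \<noteq> 0"
    and ang: "angle w (partial_u X p) = pi / 4"
  shows "second_fundamental_form X p w w = 0"
proof -
  note D = frechet_derivative_eq_partials[OF X]
  have D0: "c = 0 \<and> d = 0" if "c *\<^sub>R partial_u X p + d *\<^sub>R partial_v X p = 0" for c d
    using that injD[OF inj, of "(c, d)" "(0, 0)"] by (simp add: D zero_prod_def)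
  have u0: "partial_u X p \<noteq> 0" and v0: "partial_v X p \<noteq> 0"
    using D0[of 1 0] D0[of 0 1] by auto
  then have E: "first_E X p \<noteq> 0" and G: "first_G X p \<noteq> 0"
    by (auto simp: first_E_def first_G_def)
  \<comment> \<open>As F = 0, the denominator of the mean curvature is 2 E G, which is nonzero; so H
    = 0 really forces the numerator to vanish and is not an artefact of division by zero.\<close>
  have LN: "second_L X p * first_G X p + second_N X p * first_E X p = 0"
    using H E G F M by (simp add: mean_curvature_def)
  have ab: "a\<^sup>2 * first_E X p = b\<^sup>2 * first_G X p"
    using angle_quarter_orthogonal[OF _ u0 w ang] F
    unfolding first_E_def first_F_def first_G_def by blast
  \<comment> \<open>The factor E makes \<open>ab\<close> applicable to the L term; it is cancelled
    at the end.\<close>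
  have "first_E X p * (a\<^sup>2 * second_L X p + b\<^sup>2 * second_N X p)
      = (a\<^sup>2 * first_E X p) * second_L X p + b\<^sup>2 * (second_N X p * first_E X p)"
    by (simp add: algebra_simps)
  also have "\<dots> = b\<^sup>2 * (second_L X p * first_G X p + second_N X p * first_E X p)"
    unfolding ab by (simp add: algebra_simps)
  finally have "a\<^sup>2 * second_L X p + b\<^sup>2 * second_N X p = 0"
    using LN E by simp
  then show ?thesis
    using second_fundamental_form_partials[OF X inj w(1)] M by simp
qed

lemma rot_param_partial_u:
  assumes "(f has_real_derivative f') (at s)" "(g has_real_derivative g') (at s)"
  shows "partial_u (rot_param f g) (s, \<theta>) = vector [f' * cos \<theta>, f' * sin \<theta>, g']"
  unfolding partial_u_def rot_param_def using assms
  by (auto intro!: vector_derivative_at has_vector_derivative_vector_3 derivative_eq_intros)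

lemma rot_param_partial_v:
  "partial_v (rot_param f g) (s, \<theta>) = vector [- f s * sin \<theta>, f s * cos \<theta>, 0]"
  unfolding partial_v_def rot_param_def
  by (auto intro!: vector_derivative_at has_vector_derivative_vector_3 derivative_eq_intros)

text \<open>Meridians are orthogonal to parallels: one velocity lies in the plane of the axis and
  the radial direction, the other is perpendicular to that plane.\<close>

lemma rot_param_first_F:
  assumes "(f has_real_derivative f') (at s)" "(g has_real_derivative g') (at s)"
  shows "first_F (rot_param f g) (s, \<theta>) = 0"
  by (simp add: first_F_def rot_param_partial_u[OF assms] rot_param_partial_v
      inner_vec_def sum_3)

text \<open>The mixed derivative is a multiple of (-sin \<theta>, cos \<theta>, 0), while the cross
  product of the partials is \<open>f s\<close> times (-g' cos \<theta>, -g' sin \<theta>, f'),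
  which is orthogonal to it.\<close>

lemma rot_param_second_M:
  assumes "(f has_real_derivative f') (at s)" "(g has_real_derivative g') (at s)"
  shows "second_M (rot_param f g) (s, \<theta>) = 0"
proof -
  have "partial_v (partial_u (rot_param f g)) (s, \<theta>)
      = vector [- f' * sin \<theta>, f' * cos \<theta>, 0]"
    \<comment> \<open>Only the angle varies here while \<open>s\<close> stays fixed, so the formula
      for \<open>partial_u\<close> at \<open>s\<close> may be substituted before
      differentiating.\<close>
    unfolding partial_v_def fst_conv snd_conv rot_param_partial_u[OF assms]
    by (auto intro!: vector_derivative_at has_vector_derivative_vector_3 derivative_eq_intros)
  then show ?thesis
    by (simp add: second_M_def unit_normal_def sgn_div_norm rot_param_partial_u[OF assms]
        rot_param_partial_v cross3_def inner_vec_def sum_3 algebra_simps)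
qed

theorem corollary2:
  fixes I J :: "real set" and f g s \<theta> :: "real \<Rightarrow> real"
  assumes "minimal_rotational_surface I f g"
    and "loxodrome I f g J s \<theta> (pi / 4)"
  shows "asymptotic_curve (I \<times> UNIV) (rot_param f g) J s \<theta>"
proof -
  let ?X = "rot_param f g"
  have reg: "regular_curve_on (I \<times> UNIV) ?X J s \<theta>"
    and ang: "\<And>t. t \<in> J \<Longrightarrow>
      angle (velocity (curve_on_surface ?X s \<theta>) t) (partial_u ?X (s t, \<theta> t)) = pi / 4"
    using assms(2) unfolding loxodrome_def by auto
  have "second_fundamental_form ?X (s t, \<theta> t)
      (velocity (curve_on_surface ?X s \<theta>) t) (velocity (curve_on_surface ?X s \<theta>) t) = 0"
    if t: "t \<in> J" for t
  proof -
    have J: "open J" "smooth_on J s" "smooth_on J \<theta>"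
      and I: "s t \<in> I" and v0: "velocity (curve_on_surface ?X s \<theta>) t \<noteq> 0"
      using reg t unfolding regular_curve_on_def by auto
    have "open I" "smooth_on I f" "smooth_on I g" and X: "?X differentiable (at (s t, \<theta> t))"
      and inj: "inj (frechet_derivative ?X (at (s t, \<theta> t)))"
      and H: "mean_curvature ?X (s t, \<theta> t) = 0"
      using assms(1) I
      unfolding minimal_rotational_surface_def rotational_surface_def immersion_on_def
        minimal_on_def by auto
    then have f: "(f has_real_derivative deriv f (s t)) (at (s t))"
      and g: "(g has_real_derivative deriv g (s t)) (at (s t))"
      using I by (auto intro: smooth_on_imp_has_real_derivative)
    \<comment> \<open>The coefficients \<open>a\<close> and \<open>b\<close> of the pointwise lemma
      are the derivatives of the two coordinate functions of the loxodrome.\<close>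
    have "velocity (curve_on_surface ?X s \<theta>) t
        = deriv s t *\<^sub>R partial_u ?X (s t, \<theta> t) + deriv \<theta> t *\<^sub>R partial_v ?X (s t, \<theta> t)"
      using X J t
      by (intro velocity_curve_on_surface) (auto intro: smooth_on_imp_has_real_derivative)
    then show ?thesis
      using asymptotic_direction_of_angle_quarter[OF X inj rot_param_first_F[OF f g]
          rot_param_second_M[OF f g] H _ v0 ang[OF t]] by blast
  qed
  then show ?thesis
    using reg unfolding asymptotic_curve_def by blast
qed

end
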